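(* Let $m\ge 1$, $\varepsilon>0$, and let $L\in GL(m,\mathbb{R})$ have all (complex) eigenvalues of modulus less than $1$. Let $A$ be the unique non-empty compact subset of $\mathbb{R}^m$ with $L_\varepsilon(A)=A$, let $N_1^+\partial A$ be the outward unit normal bundle of $\partial A$, and let $b:\mathbb{R}^m\times\mathbb{S}^{m-1}\to\mathbb{R}^m\times\mathbb{S}^{m-1}$, $b(x,n)=(L(x)+\varepsilon L_\perp(n),\,L_\perp(n))$, be the boundary map. Then $$N_1^+\partial A=\{(x(n),n)\mid n\in\mathbb{S}^{m-1}\},\qquad\text{with}\quad x(n):=\varepsilon\sum_{k=0}^{\infty}L^k\big(L_\perp^{-k}(n)\big),$$ and $N_1^+\partial A$ is globally attracting under the boundary map $b$.
   Context: For a non-empty compact set $C\subset\mathbb{R}^m$, $L_\varepsilon(C)=\{x+y \mid x\in L(C),\ \|y\|\le\varepsilon\}$, where $\|\cdot\|$ is the Euclidean norm and $L(C)=\{L(x)\mid x\in C\}$. Under the eigenvalue assumption, $L_\varepsilon$ has exactly one fixed point among the non-empty compact subsets of $\mathbb{R}^m$; this fixed point is $A$. The set $A$ is convex and $\partial A$ is an $(m-1)$-dimensional $C^1$ submanifold of $\mathbb{R}^m$, so that at each $x\in\partial A$ there is a unique outward unit normal $n(x)$, i.e. a unique $n(x)\in\mathbb{S}^{m-1}$ with $\langle n(x),a-x\rangle\le 0$ for all $a\in A$. Here $\mathbb{S}^{m-1}=\{x\in\mathbb{R}^m\mid\|x\|=1\}$. The outward unit normal bundle is $N_1^+\partial A=\{(x,n(x))\mid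 x\in\partial A\}\subset\mathbb{R}^m\times\mathbb{S}^{m-1}$. The map $L_\perp:\mathbb{S}^{m-1}\to\mathbb{S}^{m-1}$ is the bijection $L_\perp(n)=\dfrac{(L^T)^{-1}n}{\|(L^T)^{-1}n\|}$, with $L^T$ the transpose of $L$, and $L_\perp^{-k}$ denotes the $k$-fold iterate of its inverse. A subset $N\subset\mathbb{R}^m\times\mathbb{S}^{m-1}$ is globally attracting under $b$ if for every $(x,n)\in\mathbb{R}^m\times\mathbb{S}^{m-1}$ the distance from $b^k(x,n)$ to $N$ tends to $0$ as $k\to\infty$ (distance in $\mathbb{R}^m\times\mathbb{S}^{m-1}\subset\mathbb{R}^{2m}$). *)

theory Defs
  imports "HOL-Analysis.Analysis"
begin

definition eigenvector :: "'a::field^'m^'m \<Rightarrow> 'a^'m \<Rightarrow> 'a \<Rightarrow> bool" where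
  "eigenvector M v c \<longleftrightarrow> v \<noteq> 0 \<and> M *v v = c *s v"

definition eigenvalue :: "'a::field^'m^'m \<Rightarrow> 'a \<Rightarrow> bool" where
  "eigenvalue M c \<longleftrightarrow> (\<exists>v. eigenvector M v c)"

definition L_eps :: "real \<Rightarrow> real^'m^'m \<Rightarrow> (real^'m) set \<Rightarrow> (real^'m) set" where
  "L_eps \<epsilon> L C = {x + y | x y. x \<in> (*v) L ` C \<and> norm y \<le> \<epsilon>}"

(* Meaningful only at points x of frontier A at which such a unit vector exists and is unique;
   elsewhere the value is unspecified. *)
definition outward_unit_normal :: "(real^'m) set \<Rightarrow> real^'m \<Rightarrow> real^'m" where
  "outward_unit_normal A x = (THE n. n \<in> sphere 0 1 \<and> (\<forall>a\<in>A. n \<bullet> (a - x) \<le> 0))"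

definition outward_unit_normal_bundle :: "(real^'m) set \<Rightarrow> ((real^'m) \<times> (real^'m)) set" where
  "outward_unit_normal_bundle A = {(x, outward_unit_normal A x) | x. x \<in> frontier A}"

(* A total function on the whole space; for invertible L it restricts to a bijection
   of the unit sphere. *)
definition L_perp :: "real^'m^'m \<Rightarrow> real^'m \<Rightarrow> real^'m" where
  "L_perp L n = (matrix_inv (transpose L) *v n) /\<^sub>R norm (matrix_inv (transpose L) *v n)"

(* The inverse is the inverse of L_perp L as a self-map of the unit sphere. *)
definition L_perp_inv :: "real^'m^'m \<Rightarrow> real^'m \<Rightarrow> real^'m" where
  "L_perp_inv L = inv_into (sphere 0 1) (L_perp L)"

definition boundary_map ::
  "real \<Rightarrow> real^'m^'m \<Rightarrow> (real^'m) \<times> (real^'m) \<Rightarrow> (real^'m) \<times> (real^'m)" where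
  "boundary_map \<epsilon> L = (\<lambda>(x, n). (L *v x + \<epsilon> *\<^sub>R L_perp L n, L_perp L n))"

(* The metric on the product type is the Euclidean one. Non-emptiness is required
   because infdist to the empty set is 0 by convention. *)
definition globally_attracting ::
  "((real^'m) \<times> (real^'m) \<Rightarrow> (real^'m) \<times> (real^'m)) \<Rightarrow> ((real^'m) \<times> (real^'m)) set \<Rightarrow> bool" where
  "globally_attracting b N \<longleftrightarrow>
     N \<noteq> {} \<and> N \<subseteq> UNIV \<times> sphere 0 1 \<and>
     (\<forall>p \<in> UNIV \<times> sphere 0 1. (\<lambda>k. infdist ((b ^^ k) p) N) \<longlonglongrightarrow> 0)"

definition x_term :: "real^'m^'m \<Rightarrow> real^'m \<Rightarrow> nat \<Rightarrow> real^'m" where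
  "x_term L n k = ((*v) L ^^ k) ((L_perp_inv L ^^ k) n)"

definition x_of_normal :: "real \<Rightarrow> real^'m^'m \<Rightarrow> real^'m \<Rightarrow> real^'m" where
  "x_of_normal \<epsilon> L n = \<epsilon> *\<^sub>R (\<Sum>k. x_term L n k)"

end

theory Submission
  imports Defs "HOL-Computational_Algebra.Fundamental_Theorem_Algebra"
begin

text \<open>
  The eigenvalue condition enters only through summability of \<open>norm (L\<^sup>k v)\<close> over \<open>k\<close>,
  for each vector \<open>v\<close>. Over the complex numbers, \<open>v\<close> is annihilated by a non-zero polynomial
  in \<open>L\<close>; its linear factors \<open>L - c\<close> are removed one by one, and each removal preserves
  summability, because either \<open>|c| < 1\<close> or \<open>L - c\<close> is injective
  (\<open>orbit_summable_of_eigenvalues\<close>). Hence \<open>L\<^sup>k u\<close> tends to \<open>0\<close>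
  uniformly for \<open>u\<close> in a bounded set, and the series defining \<open>x(n)\<close> converges.

  A bounded set \<open>C\<close> with \<open>C \<subseteq> L_eps \<epsilon> L C\<close> lies in every non-empty closed set that
  \<open>L_eps \<epsilon> L\<close> maps into itself. Taking for \<open>C\<close> the convex hull of \<open>A\<close> shows that
  \<open>A\<close> is convex, so every frontier point has a unit normal.

  The main point is the relation between normals and the decomposition \<open>x = L x' + y\<close> of
  points of \<open>A = L A + \<epsilon> B\<close>, where \<open>B\<close> is the closed unit ball. If \<open>x\<close> maximises
  \<open>n \<bullet> _\<close> over \<open>A\<close>, then \<open>y\<close> must maximise it over \<open>\<epsilon> B\<close>, so
  \<open>y = \<epsilon> n\<close>, and \<open>x'\<close> must maximise the direction \<open>transpose L *v n\<close> over
  \<open>A\<close>. The first fact makes the normal at \<open>x\<close> unique, since \<open>y\<close> was chosen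
  without reference to \<open>n\<close>. Iterating both facts gives
  \<open>x = \<epsilon> (n + L (L_perp_inv L n) + ...) + L\<^sup>k x''\<close>, and in the limit
  \<open>x = x_of_normal \<epsilon> L n\<close>. Conversely, by compactness some point of \<open>A\<close> has
  the given normal \<open>n\<close>. So the normal bundle is the graph of \<open>x_of_normal \<epsilon> L\<close>.

  The boundary map preserves the normal bundle. The orbits of \<open>(y, n)\<close> and of the bundle point
  \<open>(x, n)\<close> over the same \<open>n\<close> differ after \<open>k\<close> steps by \<open>(L\<^sup>k (y - x), 0)\<close>,
  which tends to \<open>0\<close>; this is global attraction.
\<close>

section \<open>Summability of orbits of a contracting linear map\<close>

lemma funpow_matrix_vector_mult_diff:
  fixes M :: "'a::comm_ring_1^'m^'m"
  shows "((*v) M ^^ k) (u - v) = ((*v) M ^^ k) u - ((*v) M ^^ k) v"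
  by (induction k) (simp_all add: matrix_vector_mult_diff_distrib)

lemma funpow_matrix_vector_mult_scalar:
  fixes M :: "'a::field^'m^'m"
  shows "((*v) M ^^ k) (c *s v) = c *s ((*v) M ^^ k) v"
  by (induction k) (simp_all add: vector_scalar_commute)

lemma norm_vector_scalar_mult_complex:
  fixes v :: "complex^'m"
  shows "norm (c *s v) = cmod c * norm v"
  by (simp add: norm_vec_def norm_mult L2_set_right_distrib)

definition orbit_summable :: "complex^'m^'m \<Rightarrow> complex^'m \<Rightarrow> bool" where
  "orbit_summable M v \<longleftrightarrow> summable (\<lambda>k. norm (((*v) M ^^ k) v))"

text \<open>
  With \<open>a k = norm (M\<^sup>k v)\<close> and \<open>b k = norm (M\<^sup>k (M v - c v))\<close> one has
  \<open>a (k + 1) \<le> |c| a k + b k\<close>. Summing this bounds the partial sums of \<open>a\<close> by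
  \<open>(a 0 + \<Sum>b) / (1 - |c|)\<close>.
\<close>

lemma orbit_summable_of_shift:
  fixes M :: "complex^'m^'m"
  assumes "cmod c < 1" and "orbit_summable M (M *v v - c *s v)"
  shows "orbit_summable M v"
proof -
  define a where "a k = norm (((*v) M ^^ k) v)" for k
  define b where "b k = norm (((*v) M ^^ k) (M *v v - c *s v))" for k
  have sb: "summable b" using assms(2) by (simp add: orbit_summable_def b_def[abs_def])
  have a0: "0 \<le> a k" and b0: "0 \<le> b k" for k by (simp_all add: a_def b_def)
  have step: "a (Suc k) \<le> cmod c * a k + b k" for k
  proof -
    have "((*v) M ^^ Suc k) v = c *s ((*v) M ^^ k) v + ((*v) M ^^ k) (M *v v - c *s v)"
      by (simp add: funpow_matrix_vector_mult_diff funpow_matrix_vector_mult_scalar funpow_swap1)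
    then show ?thesis
      unfolding a_def b_def by (metis norm_triangle_ineq norm_vector_scalar_mult_complex)
  qed
  have bound: "(\<Sum>k<n. a k) \<le> (a 0 + suminf b) / (1 - cmod c)" for n
  proof -
    have "(\<Sum>k<n. a k) \<le> (\<Sum>k<Suc n. a k)" using a0 by simp
    also have "\<dots> = a 0 + (\<Sum>k<n. a (Suc k))" by (rule sum.lessThan_Suc_shift)
    also have "\<dots> \<le> a 0 + (\<Sum>k<n. cmod c * a k + b k)"
      by (intro add_left_mono sum_mono step)
    also have "\<dots> = a 0 + cmod c * (\<Sum>k<n. a k) + (\<Sum>k<n. b k)"
      by (simp add: sum.distrib sum_distrib_left)
    also have "\<dots> \<le> a 0 + cmod c * (\<Sum>k<n. a k) + suminf b"
      using sum_le_suminf[OF sb, of "{..<n}"] b0 by simp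
    finally show ?thesis using assms(1) by (simp add: field_simps)
  qed
  have "summable a"
    by (rule summableI_nonneg_bounded[OF a0 bound])
  then show ?thesis by (simp add: orbit_summable_def a_def[abs_def])
qed

text \<open>
  The injective linear map \<open>M - c\<close> is bounded below on a finite-dimensional space, and it
  commutes with the powers of \<open>M\<close>, so the orbit of \<open>v\<close> is dominated by the orbit of
  \<open>(M - c) v\<close>.
\<close>

lemma orbit_summable_of_non_eigenvalue:
  fixes M :: "complex^'m^'m"
  assumes "\<not> eigenvalue M c" and "orbit_summable M (M *v v - c *s v)"
  shows "orbit_summable M v"
proof -
  define f where "f x = M *v x - c *s x" for x
  have lin: "linear f"
    by (rule linearI)
       (auto simp: f_def vec_eq_iff matrix_vector_mult_def sum.distrib algebra_simps
         scaleR_right.sum scaleR_right_diff_distrib)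
  have "inj f"
    unfolding linear_injective_0[OF lin] using assms(1)
    by (auto simp: f_def eigenvalue_def eigenvector_def)
  then obtain B where B: "B > 0" "\<And>x. B * norm x \<le> norm (f x)"
    using linear_inj_bounded_below_pos[OF lin] by blast
  have comm: "((*v) M ^^ k) (M *v v - c *s v) = f (((*v) M ^^ k) v)" for k
    by (simp add: f_def funpow_matrix_vector_mult_diff funpow_matrix_vector_mult_scalar funpow_swap1)
  have "summable (\<lambda>k. inverse B * norm (f (((*v) M ^^ k) v)))"
    using assms(2) by (intro summable_mult) (simp add: orbit_summable_def comm)
  then show ?thesis unfolding orbit_summable_def
  proof (rule summable_comparison_test'[where N = 0])
    fix k show "norm (norm (((*v) M ^^ k) v)) \<le> inverse B * norm (f (((*v) M ^^ k) v))"
      using B(2)[of "((*v) M ^^ k) v"] B(1) by (simp add: field_simps)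
  qed
qed

text \<open>
  This is \<open>p(M) v\<close>, evaluated by Horner's scheme; matrices do not form a commutative ring,
  so \<open>poly\<close> cannot be applied to \<open>M\<close> itself.
\<close>

definition poly_action :: "complex^'m^'m \<Rightarrow> complex poly \<Rightarrow> complex^'m \<Rightarrow> complex^'m" where
  "poly_action M p v = fold_coeffs (\<lambda>a w. a *s v + M *v w) p 0"

lemma poly_action_0 [simp]: "poly_action M 0 v = 0"
  by (simp add: poly_action_def)

lemma poly_action_pCons [simp]:
  "poly_action M (pCons a p) v = a *s v + M *v poly_action M p v"
  by (cases "p = 0 \<and> a = 0") (auto simp: poly_action_def)

lemma poly_action_add: "poly_action M (p + q) v = poly_action M p v + poly_action M q v"
  by (induction p q rule: poly_induct2)
     (simp_all add: matrix_vector_right_distrib vector_sadd_rdistrib)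

lemma poly_action_smult: "poly_action M (smult c p) v = c *s poly_action M p v"
  by (induction p)
     (simp_all add: vector_scalar_commute vector_add_ldistrib vector_smult_assoc)

lemma poly_action_linear_factor:
  "poly_action M ([:- c, 1:] * q) v = M *v poly_action M q v - c *s poly_action M q v"
proof -
  have "[:- c, 1:] * q = smult (- c) q + pCons 0 q" by simp
  then show ?thesis
    by (simp only: poly_action_add poly_action_smult poly_action_pCons) (simp add: vec_eq_iff)
qed

lemma poly_action_monom: "poly_action M (monom 1 k) v = ((*v) M ^^ k) v"
  by (induction k) (simp_all add: monom_Suc monom_0)

text \<open>
  Otherwise the initial segments of the sequence would be linearly independent sets of unbounded
  size.
\<close>

lemma exists_element_in_span_of_predecessors:
  fixes a :: "nat \<Rightarrow> 'a::euclidean_space"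
  shows "\<exists>k. a k \<in> span (a ` {..<k})"
proof (rule ccontr)
  assume "\<not> ?thesis"
  then have new: "a k \<notin> span (a ` {..<k})" for k by blast
  have "independent (a ` {..<k}) \<and> card (a ` {..<k}) = k" for k
  proof (induction k)
    case (Suc k)
    have "a k \<notin> a ` {..<k}" using new[of k] by (metis span_base)
    then show ?case
      using Suc new[of k] by (simp add: lessThan_Suc independent_insert)
  qed (simp add: independent_empty)
  from this[of "Suc DIM('a)"] show False
    using independent_bound[of "a ` {..<Suc DIM('a)}"] by simp
qed

text \<open>
  Some \<open>M\<^sup>k v\<close> lies in the span of the earlier orbit points. These points, and hence
  their span, lie in the set of all \<open>p(M) v\<close> whose polynomial \<open>p\<close> has no term in degree
  \<open>k\<close>; so \<open>X\<^sup>k - p\<close> annihilates \<open>v\<close> for a suitable such \<open>p\<close>, and its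
  coefficient of \<open>X\<^sup>k\<close> is \<open>1\<close>.
\<close>

lemma exists_annihilating_poly:
  fixes M :: "complex^'m^'m"
  obtains p where "p \<noteq> 0" and "poly_action M p v = 0"
proof -
  obtain k where k: "((*v) M ^^ k) v \<in> span ((\<lambda>i. ((*v) M ^^ i) v) ` {..<k})"
    using exists_element_in_span_of_predecessors[of "\<lambda>i. ((*v) M ^^ i) v"] by blast
  define S where "S = {poly_action M p v | p. coeff p k = 0}"
  have "subspace S"
    unfolding subspace_def
  proof (intro conjI ballI allI)
    show "0 \<in> S" unfolding S_def by (rule CollectI, rule exI[of _ 0]) simp
  next
    fix x y assume "x \<in> S" "y \<in> S"
    then obtain p q where "x = poly_action M p v" "y = poly_action M q v"
      "coeff p k = 0" "coeff q k = 0" by (auto simp: S_def)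
    then show "x + y \<in> S"
      unfolding S_def by (intro CollectI exI[of _ "p + q"]) (simp add: poly_action_add)
  next
    fix r :: real and x assume "x \<in> S"
    then obtain p where p: "x = poly_action M p v" "coeff p k = 0" by (auto simp: S_def)
    have "r *\<^sub>R x = of_real r *s x" by (simp add: vec_eq_iff scaleR_conv_of_real[symmetric])
    with p show "r *\<^sub>R x \<in> S"
      unfolding S_def by (intro CollectI exI[of _ "smult (of_real r) p"]) (simp add: poly_action_smult)
  qed
  moreover have "(\<lambda>i. ((*v) M ^^ i) v) ` {..<k} \<subseteq> S"
    unfolding S_def by (force simp: poly_action_monom[symmetric])
  ultimately have "((*v) M ^^ k) v \<in> S" using k span_minimal by blast
  then obtain p where p: "((*v) M ^^ k) v = poly_action M p v" "coeff p k = 0"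
    by (auto simp: S_def)
  show ?thesis
  proof
    show "monom 1 k + smult (-1) p \<noteq> 0"
    proof
      assume "monom 1 k + smult (-1) p = 0"
      then have "coeff (monom 1 k + smult (-1) p) k = 0" by (simp only: coeff_0)
      then show False using p(2) by simp
    qed
    show "poly_action M (monom 1 k + smult (-1) p) v = 0"
      by (simp only: poly_action_add poly_action_smult poly_action_monom p(1)) (simp add: vec_eq_iff)
  qed
qed

text \<open>
  By the fundamental theorem of algebra, \<open>p\<close> can be stripped of its linear factors
  \<open>X - c\<close> one at a time. If \<open>c\<close> is an eigenvalue then \<open>|c| < 1\<close>
  and \<open>orbit_summable_of_shift\<close> applies, otherwise \<open>orbit_summable_of_non_eigenvalue\<close> does.
\<close>

lemma orbit_summable_of_poly_action:
  fixes M :: "complex^'m^'m"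
  assumes ev: "\<And>c. eigenvalue M c \<Longrightarrow> cmod c < 1"
    and "p \<noteq> 0" and "orbit_summable M (poly_action M p v)"
  shows "orbit_summable M v"
  using assms(2,3)
proof (induction "degree p" arbitrary: p)
  case 0
  then have "degree p = 0" by simp
  then obtain a where a: "p = [:a:]" by (rule degree_eq_zeroE)
  with 0 have a0: "a \<noteq> 0" by auto
  have "poly_action M p v = a *s v" unfolding a by simp
  with 0 have "summable (\<lambda>k. cmod a * norm (((*v) M ^^ k) v))"
    by (simp add: orbit_summable_def funpow_matrix_vector_mult_scalar norm_vector_scalar_mult_complex)
  then show ?case using a0 by (simp add: orbit_summable_def)
next
  case (Suc d)
  then have "\<not> constant (poly p)" by (simp add: constant_degree)
  then obtain c where "poly p c = 0" using fundamental_theorem_of_algebra by blast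
  then obtain q where q: "p = [:- c, 1:] * q" 
    unfolding poly_eq_0_iff_dvd by (rule dvdE)
  have q0: "q \<noteq> 0" using q Suc.prems(1) by (metis mult_zero_right)
  have "degree p = degree [:- c, 1:] + degree q" unfolding q using q0 by (intro degree_mult_eq) simp_all
  then have d: "d = degree q" using Suc.hyps(2) by simp
  have "orbit_summable M (M *v poly_action M q v - c *s poly_action M q v)"
    using Suc.prems(2) unfolding q poly_action_linear_factor .
  then have "orbit_summable M (poly_action M q v)"
    using ev[of c] orbit_summable_of_shift[of c M "poly_action M q v"]
      orbit_summable_of_non_eigenvalue[of M c "poly_action M q v"] by linarith
  then show ?case by (rule Suc.hyps(1)[OF d q0])
qed

lemma orbit_summable_of_eigenvalues:
  fixes M :: "complex^'m^'m"
  assumes "\<And>c. eigenvalue M c \<Longrightarrow> cmod c < 1"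
  shows "orbit_summable M v"
proof -
  obtain p where "p \<noteq> 0" "poly_action M p v = 0" by (rule exists_annihilating_poly)
  moreover have "((*v) M ^^ k) 0 = 0" for k by (induction k) simp_all
  ultimately show ?thesis
    using orbit_summable_of_poly_action[of M p v] assms by (simp add: orbit_summable_def)
qed

definition complexify :: "real^'m \<Rightarrow> complex^'m" where
  "complexify v = (\<chi> i. complex_of_real (v $ i))"

lemma norm_complexify: "norm (complexify v) = norm v"
  by (simp add: complexify_def norm_vec_def)

lemma funpow_complexify:
  fixes L :: "real^'m^'m"
  shows "((*v) (map_matrix complex_of_real L) ^^ k) (complexify v) = complexify (((*v) L ^^ k) v)"
proof (induction k)
  case (Suc k)
  have "map_matrix complex_of_real L *v complexify w = complexify (L *v w)" for w :: "real^'m"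
    by (simp add: complexify_def matrix_vector_mult_def vec_eq_iff)
  with Suc show ?case by simp
qed simp

lemma summable_norm_funpow:
  fixes L :: "real^'m^'m"
  assumes "\<forall>c. eigenvalue (map_matrix complex_of_real L) c \<longrightarrow> cmod c < 1"
  shows "summable (\<lambda>k. norm (((*v) L ^^ k) v))"
  using orbit_summable_of_eigenvalues[of "map_matrix complex_of_real L" "complexify v"] assms
  by (simp add: orbit_summable_def funpow_complexify norm_complexify)

lemma linear_funpow_matrix:
  fixes L :: "real^'m^'m"
  shows "linear ((*v) L ^^ k)"
proof (induction k)
  case (Suc k)
  then show ?case
    unfolding funpow.simps by (intro linear_compose) simp_all
qed (simp add: linear_iff)

text \<open>
  Each \<open>u k\<close> is expanded in the standard basis, so that the finitely many basis orbits give a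
  majorant that is uniform in the choice of \<open>u\<close>.
\<close>

lemma summable_norm_funpow_bounded:
  fixes L :: "real^'m^'m"
  assumes ev: "\<forall>c. eigenvalue (map_matrix complex_of_real L) c \<longrightarrow> cmod c < 1"
    and u: "\<And>k. norm (u k) \<le> R"
  shows "summable (\<lambda>k. norm (((*v) L ^^ k) (u k)))"
proof (rule summable_comparison_test'[where N = 0])
  show "summable (\<lambda>k. R * (\<Sum>b\<in>Basis. norm (((*v) L ^^ k) b)))"
    by (intro summable_mult summable_sum summable_norm_funpow ev)
next
  fix k
  interpret linear "(*v) L ^^ k" by (rule linear_funpow_matrix)
  have "norm (((*v) L ^^ k) (u k)) = norm (((*v) L ^^ k) (\<Sum>b\<in>Basis. (u k \<bullet> b) *\<^sub>R b))"
    by (simp add: euclidean_representation)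
  also have "\<dots> = norm (\<Sum>b\<in>Basis. (u k \<bullet> b) *\<^sub>R ((*v) L ^^ k) b)"
    by (simp add: sum scaleR)
  also have "\<dots> \<le> (\<Sum>b\<in>Basis. R * norm (((*v) L ^^ k) b))"
    using u[of k] by (intro sum_norm_le)
      (auto intro!: mult_right_mono intro: order_trans[OF Basis_le_norm])
  finally show "norm (norm (((*v) L ^^ k) (u k))) \<le> R * (\<Sum>b\<in>Basis. norm (((*v) L ^^ k) b))"
    by (simp add: sum_distrib_left)
qed

lemma funpow_bounded_tendsto_0:
  fixes L :: "real^'m^'m"
  assumes "\<forall>c. eigenvalue (map_matrix complex_of_real L) c \<longrightarrow> cmod c < 1"
    and "bounded (range u)"
  shows "(\<lambda>k. ((*v) L ^^ k) (u k)) \<longlonglongrightarrow> 0"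
proof -
  obtain R where "\<And>k. norm (u k) \<le> R" using assms(2) by (auto simp: bounded_iff)
  from summable_LIMSEQ_zero[OF summable_norm_funpow_bounded[OF assms(1) this]]
  show ?thesis by (simp add: tendsto_norm_zero_iff)
qed

section \<open>Convexity of fixed sets\<close>

lemma mem_L_eps_iff:
  "z \<in> L_eps \<epsilon> L C \<longleftrightarrow> (\<exists>x\<in>C. \<exists>y. norm y \<le> \<epsilon> \<and> z = L *v x + y)"
  by (auto simp: L_eps_def)

lemma L_eps_memI: "x \<in> C \<Longrightarrow> norm y \<le> \<epsilon> \<Longrightarrow> L *v x + y \<in> L_eps \<epsilon> L C"
  by (auto simp: mem_L_eps_iff)

text \<open>
  Write \<open>z \<in> C\<close> as \<open>L z' + y\<close> with \<open>z' \<in> C\<close>, and repeat this for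
  \<open>z'\<close>. Applying the same \<open>k\<close> translations \<open>y\<close> to an arbitrary point \<open>a0\<close> of
  \<open>A\<close> in place of the last point \<open>c\<close> of \<open>C\<close> produces a point of \<open>A\<close> that differs
  from \<open>z\<close> by \<open>L\<^sup>k (c - a0)\<close>, which tends to \<open>0\<close>.
\<close>

lemma bounded_subinvariant_subset:
  fixes L :: "real^'m^'m"
  assumes ev: "\<forall>c. eigenvalue (map_matrix complex_of_real L) c \<longrightarrow> cmod c < 1"
    and A: "closed A" "A \<noteq> {}" "L_eps \<epsilon> L A \<subseteq> A"
    and C: "bounded C" "C \<subseteq> L_eps \<epsilon> L C"
  shows "C \<subseteq> A"
proof
  fix z assume z: "z \<in> C"
  obtain a0 where a0: "a0 \<in> A" using A(2) by blast
  have "\<exists>c\<in>C. \<exists>a\<in>A. z - a = ((*v) L ^^ k) (c - a0)" for k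
    using z
  proof (induction k arbitrary: z)
    case 0
    then show ?case using a0 by auto
  next
    case (Suc k)
    then obtain z' y where z': "z' \<in> C" "norm y \<le> \<epsilon>" "z = L *v z' + y"
      using C(2) by (meson mem_L_eps_iff subsetD)
    obtain c a where ca: "c \<in> C" "a \<in> A" "z' - a = ((*v) L ^^ k) (c - a0)"
      using Suc.IH[OF z'(1)] by blast
    have "L *v a + y \<in> A" using A(3) ca(2) z'(2) by (blast intro: L_eps_memI)
    moreover have "z - (L *v a + y) = ((*v) L ^^ Suc k) (c - a0)"
      using z'(3) ca(3) by (simp add: matrix_vector_mult_diff_distrib[symmetric])
    ultimately show ?case using ca(1) by blast
  qed
  then obtain c a where c: "\<And>k. c k \<in> C" and a: "\<And>k. a k \<in> A"
    and eq: "\<And>k. z - a k = ((*v) L ^^ k) (c k - a0)" by metis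
  have "bounded (range (\<lambda>k. c k - a0))"
    using bounded_translation_minus[OF C(1), of a0] c by (elim bounded_subset) auto
  from funpow_bounded_tendsto_0[OF ev this] have "(\<lambda>k. z - a k) \<longlonglongrightarrow> 0"
    by (simp add: eq)
  from tendsto_diff[OF tendsto_const this, of z] have "a \<longlonglongrightarrow> z" by simp
  then show "z \<in> A" using A(1) a closed_sequentially by blast
qed

lemma L_eps_eq_sum: "L_eps \<epsilon> L C = (\<Union>x\<in>(*v) L ` C. \<Union>y\<in>cball 0 \<epsilon>. {x + y})"
  unfolding L_eps_def by fastforce

text \<open>
  The convex hull of a fixed set \<open>A\<close> is subinvariant, because the image of a convex set under
  \<open>L_eps\<close> is convex. By \<open>bounded_subinvariant_subset\<close> the hull is thus contained in
  \<open>A\<close>.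
\<close>

lemma convex_L_eps_fixed:
  fixes L :: "real^'m^'m"
  assumes ev: "\<forall>c. eigenvalue (map_matrix complex_of_real L) c \<longrightarrow> cmod c < 1"
    and A: "compact A" "A \<noteq> {}" "L_eps \<epsilon> L A = A"
  shows "convex A"
proof -
  have "A \<subseteq> L_eps \<epsilon> L (convex hull A)"
    using A(3) hull_subset[of A convex] unfolding L_eps_def by blast
  moreover have "convex (L_eps \<epsilon> L (convex hull A))"
    unfolding L_eps_eq_sum by (intro convex_sums convex_linear_image) auto
  ultimately have "convex hull A \<subseteq> L_eps \<epsilon> L (convex hull A)" by (rule hull_minimal)
  moreover have "bounded (convex hull A)"
    using A(1) by (simp add: bounded_convex_hull compact_imp_bounded)
  ultimately have "convex hull A \<subseteq> A"
    using bounded_subinvariant_subset[OF ev compact_imp_closed[OF A(1)] A(2) equalityD1[OF A(3)]] by blast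
  then show ?thesis by (metis convex_convex_hull hull_subset subset_antisym)
qed

section \<open>The action on unit normals\<close>

lemma inner_transpose_mult: "(transpose L *v m) \<bullet> x = m \<bullet> (L *v (x :: real^'m))"
  by (simp add: dot_lmul_matrix transpose_matrix_vector)

lemma matrix_inv_cancel:
  assumes "invertible M"
  shows "M ** matrix_inv M = mat 1" and "matrix_inv M ** M = mat 1"
  using someI_ex[OF assms[unfolded invertible_def]] unfolding matrix_inv_def by auto

lemma transpose_L_perp:
  fixes L :: "real^'m^'m"
  assumes "invertible L" and "n \<in> sphere 0 1"
  obtains c where "c > 0" and "transpose L *v L_perp L n = c *\<^sub>R n" and "L_perp L n \<in> sphere 0 1"
proof -
  define w where "w = matrix_inv (transpose L) *v n"
  have "invertible (transpose L)" using assms(1) by (rule transpose_invertible)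
  then have w: "transpose L *v w = n"
    unfolding w_def by (simp add: matrix_vector_mul_assoc matrix_inv_cancel)
  with assms(2) have "w \<noteq> 0" by auto
  show ?thesis
  proof
    show "inverse (norm w) > 0" using \<open>w \<noteq> 0\<close> by simp
    show "transpose L *v L_perp L n = inverse (norm w) *\<^sub>R n"
      unfolding L_perp_def w_def[symmetric] using w by (simp add: matrix_vector_mult_scaleR)
    show "L_perp L n \<in> sphere 0 1"
      unfolding L_perp_def w_def[symmetric] using \<open>w \<noteq> 0\<close> by simp
  qed
qed

text \<open>
  The preimage of \<open>n\<close> is the normalisation of \<open>transpose L *v n\<close>, so \<open>L_perp L\<close>
  maps the sphere onto itself; surjectivity is what makes \<open>inv_into\<close> a right inverse.
\<close>

lemma L_perp_inv:
  fixes L :: "real^'m^'m"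
  assumes "invertible L" and "n \<in> sphere 0 1"
  shows "L_perp_inv L n \<in> sphere 0 1" and "L_perp L (L_perp_inv L n) = n"
proof -
  define w where "w = transpose L *v n"
  have inv: "invertible (transpose L)" using assms(1) by (rule transpose_invertible)
  then have w: "matrix_inv (transpose L) *v w = n"
    unfolding w_def matrix_vector_mul_assoc by (simp only: matrix_inv_cancel matrix_vector_mul_lid)
  with assms(2) have "w \<noteq> 0" by auto
  then have "L_perp L (w /\<^sub>R norm w) = n"
    using assms(2) by (simp add: L_perp_def matrix_vector_mult_scaleR w)
  moreover have "w /\<^sub>R norm w \<in> sphere 0 1" using \<open>w \<noteq> 0\<close> by simp
  ultimately have "n \<in> L_perp L ` sphere 0 1" by blast
  then show "L_perp_inv L n \<in> sphere 0 1" "L_perp L (L_perp_inv L n) = n"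
    unfolding L_perp_inv_def by (rule inv_into_into, rule f_inv_into_f)
qed

section \<open>Outer normals under one step of the boundary map\<close>

text \<open>
  A relation between points and normals, in place of the definite description in
  \<open>outward_unit_normal\<close>: it makes sense before existence and uniqueness are known.
\<close>

definition outer_normal :: "(real^'m) set \<Rightarrow> real^'m \<Rightarrow> real^'m \<Rightarrow> bool" where
  "outer_normal A x n \<longleftrightarrow> x \<in> A \<and> (\<forall>a\<in>A. n \<bullet> (a - x) \<le> 0)"

text \<open>
  For \<open>m = L_perp L n\<close>, a point \<open>L a' + y\<close> of \<open>A\<close> has height
  \<open>m \<bullet> L a' + m \<bullet> y\<close> in direction \<open>m\<close>. Since \<open>transpose L *v m\<close> is a positive
  multiple of \<open>n\<close>, the first summand is largest at \<open>a' = x\<close>; the second is at most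
  \<open>\<epsilon>\<close>, the value attained at \<open>y = \<epsilon> m\<close>.
\<close>

lemma outer_normal_image:
  fixes L :: "real^'m^'m"
  assumes "\<epsilon> \<ge> 0" "invertible L" "L_eps \<epsilon> L A = A"
    and n: "n \<in> sphere 0 1" and xn: "outer_normal A x n"
  shows "outer_normal A (L *v x + \<epsilon> *\<^sub>R L_perp L n) (L_perp L n)"
  unfolding outer_normal_def
proof (intro conjI ballI)
  define m where "m = L_perp L n"
  obtain c where c: "c > 0" "transpose L *v m = c *\<^sub>R n" "m \<in> sphere 0 1"
    using transpose_L_perp[OF assms(2) n] unfolding m_def by blast
  show "L *v x + \<epsilon> *\<^sub>R L_perp L n \<in> A"
    using L_eps_memI[of x A "\<epsilon> *\<^sub>R m" \<epsilon> L] c(3) xn assms(1,3)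
    by (simp add: m_def outer_normal_def)
  fix a assume "a \<in> A"
  then obtain a' y where a': "a' \<in> A" "norm y \<le> \<epsilon>" "a = L *v a' + y"
    using assms(3) by (metis mem_L_eps_iff)
  have "m \<bullet> y \<le> \<epsilon>" using norm_cauchy_schwarz[of m y] a'(2) c(3) by simp
  moreover have "m \<bullet> (L *v (a' - x)) \<le> 0"
    using xn a'(1) c(1) unfolding inner_transpose_mult[symmetric] c(2)
    by (simp add: outer_normal_def mult_le_0_iff)
  moreover have "m \<bullet> m = 1" using c(3) by (simp add: dot_square_norm)
  ultimately show "L_perp L n \<bullet> (a - (L *v x + \<epsilon> *\<^sub>R L_perp L n)) \<le> 0"
    unfolding m_def[symmetric] a'(3)
    by (simp add: matrix_vector_mult_diff_distrib inner_diff_right inner_add_right)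
qed

text \<open>
  Replacing \<open>y\<close> by \<open>\<epsilon> n\<close> gives another point of \<open>A\<close>, so maximality in
  direction \<open>n\<close> yields \<open>n \<bullet> y \<ge> \<epsilon>\<close>; in the ball of radius \<open>\<epsilon>\<close> only
  \<open>\<epsilon> n\<close> satisfies this.
\<close>

lemma outer_normal_offset:
  fixes L :: "real^'m^'m"
  assumes "\<epsilon> \<ge> 0" "L_eps \<epsilon> L A = A"
    and n: "n \<in> sphere 0 1" and xn: "outer_normal A (L *v x' + y) n"
    and x': "x' \<in> A" and y: "norm y \<le> \<epsilon>"
  shows "y = \<epsilon> *\<^sub>R n"
proof -
  have "L *v x' + \<epsilon> *\<^sub>R n \<in> A"
    using L_eps_memI[of x' A "\<epsilon> *\<^sub>R n" \<epsilon> L] n x' assms(1,2) by simp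
  then have "n \<bullet> (\<epsilon> *\<^sub>R n - y) \<le> 0" using xn by (auto simp: outer_normal_def)
  moreover have nn: "n \<bullet> n = 1" using n by (simp add: dot_square_norm)
  ultimately have 1: "\<epsilon> \<le> n \<bullet> y" by (simp add: inner_diff_right)
  have "(norm (y - \<epsilon> *\<^sub>R n))\<^sup>2 = (norm y)\<^sup>2 - 2 * \<epsilon> * (n \<bullet> y) + \<epsilon>\<^sup>2"
    unfolding power2_norm_eq_inner using nn
    by (simp add: inner_diff_left inner_diff_right inner_commute power2_eq_square algebra_simps)
  also have "\<dots> \<le> \<epsilon>\<^sup>2 - 2 * \<epsilon> * \<epsilon> + \<epsilon>\<^sup>2"
    using y assms(1) 1 by (intro add_mono diff_mono mult_left_mono power_mono) auto
  also have "\<dots> = 0" by (simp add: power2_eq_square)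
  finally show ?thesis by simp
qed

text \<open>
  The offset \<open>y\<close> in a decomposition \<open>x = L x' + y\<close> does not depend on a normal, yet it
  equals \<open>\<epsilon>\<close> times every unit normal at \<open>x\<close>. This is where smoothness of the
  boundary comes from.
\<close>

lemma outer_normal_unique:
  fixes L :: "real^'m^'m"
  assumes "\<epsilon> > 0" "L_eps \<epsilon> L A = A"
    and "n \<in> sphere 0 1" "outer_normal A x n" and "m \<in> sphere 0 1" "outer_normal A x m"
  shows "n = m"
proof -
  have "x \<in> A" using assms(4) by (simp add: outer_normal_def)
  then obtain x' y where "x' \<in> A" "norm y \<le> \<epsilon>" "x = L *v x' + y"
    using assms(2) by (metis mem_L_eps_iff)
  then have "y = \<epsilon> *\<^sub>R n" "y = \<epsilon> *\<^sub>R m"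
    using assms outer_normal_offset[of \<epsilon> L A _ x' y] by auto
  then show ?thesis using assms(1) by simp
qed

text \<open>
  One step backwards along the boundary map: the offset at \<open>x\<close> is forced to be
  \<open>\<epsilon> n\<close>, and maximality of \<open>x\<close> in direction \<open>n\<close> passes to maximality of
  \<open>x'\<close> in direction \<open>transpose L *v n\<close>.
\<close>

lemma outer_normal_preimage:
  fixes L :: "real^'m^'m"
  assumes "\<epsilon> \<ge> 0" "invertible L" "L_eps \<epsilon> L A = A"
    and n: "n \<in> sphere 0 1" and xn: "outer_normal A x n"
  obtains x' where "outer_normal A x' (L_perp_inv L n)" and "x = L *v x' + \<epsilon> *\<^sub>R n"
proof -
  have "x \<in> A" using xn by (simp add: outer_normal_def)
  then obtain x' y where x': "x' \<in> A" "norm y \<le> \<epsilon>" "x = L *v x' + y"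
    using assms(3) by (metis mem_L_eps_iff)
  then have x: "x = L *v x' + \<epsilon> *\<^sub>R n"
    using outer_normal_offset[OF assms(1,3) n, of x' y] xn by simp
  define n' where "n' = L_perp_inv L n"
  have n': "n' \<in> sphere 0 1" "L_perp L n' = n"
    unfolding n'_def using L_perp_inv[OF assms(2) n] by auto
  obtain c where c: "c > 0" "transpose L *v n = c *\<^sub>R n'"
    using transpose_L_perp[OF assms(2) n'(1)] n'(2) by metis
  have "n' \<bullet> (a - x') \<le> 0" if "a \<in> A" for a
  proof -
    have "L *v a + \<epsilon> *\<^sub>R n \<in> A"
      using L_eps_memI[of a A "\<epsilon> *\<^sub>R n" \<epsilon> L] that n assms(1,3) by simp
    then have "n \<bullet> (L *v a + \<epsilon> *\<^sub>R n - x) \<le> 0" using xn by (auto simp: outer_normal_def)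
    moreover have "L *v a + \<epsilon> *\<^sub>R n - x = L *v (a - x')"
      unfolding x by (simp add: matrix_vector_mult_diff_distrib)
    ultimately have "n \<bullet> (L *v (a - x')) \<le> 0" by simp
    then show ?thesis
      using c(1) unfolding inner_transpose_mult[symmetric] c(2) by (simp add: mult_le_0_iff)
  qed
  then have "outer_normal A x' n'" using x'(1) by (simp add: outer_normal_def)
  then show ?thesis using x that unfolding n'_def by blast
qed

section \<open>The point with a given normal\<close>

lemma L_perp_inv_funpow_sphere:
  fixes L :: "real^'m^'m"
  assumes "invertible L" and "n \<in> sphere 0 1"
  shows "(L_perp_inv L ^^ k) n \<in> sphere 0 1"
proof (induction k)
  case (Suc k)
  then show ?case using L_perp_inv(1)[OF assms(1)] by simp
qed (use assms in simp)

text \<open>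
  The offsets met along the backward orbit of \<open>(x, n)\<close> under the boundary map are
  \<open>\<epsilon>\<close> times the successive normals; pushed forward to \<open>x\<close> by powers of \<open>L\<close>,
  they are the terms of the series for \<open>x(n)\<close>.
\<close>

lemma outer_normal_expansion:
  fixes L :: "real^'m^'m"
  assumes "\<epsilon> \<ge> 0" "invertible L" "L_eps \<epsilon> L A = A"
    and "n \<in> sphere 0 1" and "outer_normal A x n"
  shows "\<exists>x'\<in>A. x = \<epsilon> *\<^sub>R (\<Sum>j<k. x_term L n j) + ((*v) L ^^ k) x'"
  using assms(4,5)
proof (induction k arbitrary: n x)
  case 0
  then show ?case by (auto simp: outer_normal_def)
next
  case (Suc k)
  obtain x' where x': "outer_normal A x' (L_perp_inv L n)" "x = L *v x' + \<epsilon> *\<^sub>R n"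
    using outer_normal_preimage[OF assms(1-3) Suc.prems] by blast
  obtain x'' where x'': "x'' \<in> A"
    "x' = \<epsilon> *\<^sub>R (\<Sum>j<k. x_term L (L_perp_inv L n) j) + ((*v) L ^^ k) x''"
    using Suc.IH[OF L_perp_inv(1)[OF assms(2) Suc.prems(1)] x'(1)] by blast
  have "L *v x_term L (L_perp_inv L n) j = x_term L n (Suc j)" for j
    by (simp add: x_term_def funpow_swap1)
  then have "L *v (\<Sum>j<k. x_term L (L_perp_inv L n) j) = (\<Sum>j<k. x_term L n (Suc j))"
    by (simp add: linear_sum[OF matrix_vector_mul_linear])
  moreover have "x_term L n 0 = n" by (simp add: x_term_def)
  ultimately have "x = \<epsilon> *\<^sub>R (\<Sum>j<Suc k. x_term L n j) + ((*v) L ^^ Suc k) x''"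
    unfolding x'(2) x''(2) sum.lessThan_Suc_shift
    by (simp add: matrix_vector_right_distrib matrix_vector_mult_scaleR scaleR_add_right)
  then show ?case using x''(1) by blast
qed

lemma summable_x_term:
  fixes L :: "real^'m^'m"
  assumes ev: "\<forall>c. eigenvalue (map_matrix complex_of_real L) c \<longrightarrow> cmod c < 1"
    and "invertible L" and "n \<in> sphere 0 1"
  shows "summable (x_term L n)"
proof -
  have "norm ((L_perp_inv L ^^ k) n) \<le> 1" for k
    using L_perp_inv_funpow_sphere[OF assms(2,3), of k] by simp
  from summable_norm_funpow_bounded[OF ev this] have "summable (\<lambda>k. norm (x_term L n k))"
    by (simp add: x_term_def)
  then show ?thesis by (rule summable_norm_cancel)
qed

text \<open>
  In the \<open>k\<close>-step expansion of \<open>x\<close> the remainder is \<open>L\<^sup>k\<close> applied to a point of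
  the bounded set \<open>A\<close>, so it vanishes in the limit. In particular, \<open>n\<close> determines
  \<open>x\<close>: \<open>A\<close> is strictly convex.
\<close>

lemma outer_normal_eq_x_of_normal:
  fixes L :: "real^'m^'m"
  assumes ev: "\<forall>c. eigenvalue (map_matrix complex_of_real L) c \<longrightarrow> cmod c < 1"
    and L: "\<epsilon> \<ge> 0" "invertible L" "L_eps \<epsilon> L A = A" and "bounded A"
    and n: "n \<in> sphere 0 1" and xn: "outer_normal A x n"
  shows "x = x_of_normal \<epsilon> L n"
proof -
  have "\<forall>k. \<exists>x'. x' \<in> A \<and> x = \<epsilon> *\<^sub>R (\<Sum>j<k. x_term L n j) + ((*v) L ^^ k) x'"
    using outer_normal_expansion[OF L n xn] by blast
  then obtain x' where x': "\<And>k. x' k \<in> A"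
    "\<And>k. x = \<epsilon> *\<^sub>R (\<Sum>j<k. x_term L n j) + ((*v) L ^^ k) (x' k)"
    by metis
  have "bounded (range x')" using \<open>bounded A\<close> x'(1) by (elim bounded_subset) auto
  then have "(\<lambda>k. ((*v) L ^^ k) (x' k)) \<longlonglongrightarrow> 0"
    using funpow_bounded_tendsto_0[OF ev] by blast
  moreover have "(\<lambda>k. \<Sum>j<k. x_term L n j) \<longlonglongrightarrow> (\<Sum>k. x_term L n k)"
    using summable_x_term[OF ev L(2) n] by (rule summable_LIMSEQ)
  ultimately have "(\<lambda>k. \<epsilon> *\<^sub>R (\<Sum>j<k. x_term L n j) + ((*v) L ^^ k) (x' k))
      \<longlonglongrightarrow> \<epsilon> *\<^sub>R (\<Sum>k. x_term L n k) + 0"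
    by (intro tendsto_intros)
  then have "(\<lambda>k. x) \<longlonglongrightarrow> x_of_normal \<epsilon> L n"
    by (simp add: x'(2)[symmetric] x_of_normal_def)
  then show ?thesis by (simp add: LIMSEQ_const_iff)
qed

section \<open>The outward unit normal bundle\<close>

lemma exists_outer_normal_point:
  assumes "compact A" "A \<noteq> {}"
  obtains x where "outer_normal A x n"
proof -
  have "\<exists>x\<in>A. \<forall>a\<in>A. n \<bullet> a \<le> n \<bullet> x"
    by (rule continuous_attains_sup[OF assms]) (intro continuous_intros)
  then show ?thesis using that by (auto simp: outer_normal_def inner_diff_right)
qed

lemma outer_normal_imp_frontier:
  assumes "n \<noteq> 0" and "outer_normal A x n"
  shows "x \<in> frontier A"
proof -
  have "x \<notin> interior A"
  proof
    assume "x \<in> interior A"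
    then obtain e where e: "e > 0" "cball x e \<subseteq> A" by (auto simp: mem_interior_cball)
    define a where "a = x + (e / norm n) *\<^sub>R n"
    have "a \<in> A" using e assms(1) by (auto simp: a_def dist_norm intro!: subsetD[OF e(2)])
    then have "n \<bullet> (a - x) \<le> 0" using assms(2) by (auto simp: outer_normal_def)
    then have "(e / norm n) * (n \<bullet> n) \<le> 0" by (simp add: a_def)
    moreover have "(e / norm n) * (n \<bullet> n) > 0" using e(1) assms(1) by simp
    ultimately show False by linarith
  qed
  moreover have "x \<in> closure A" using assms(2) closure_subset by (auto simp: outer_normal_def)
  ultimately show ?thesis by (simp add: frontier_def)
qed

text \<open>
  With non-empty interior, the frontier is the relative boundary, where supporting hyperplanes exist.
\<close>

lemma frontier_imp_exists_outer_normal: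
  fixes A :: "(real^'m) set"
  assumes "closed A" "convex A" "interior A \<noteq> {}" "x \<in> frontier A"
  obtains n where "n \<in> sphere 0 1" and "outer_normal A x n"
proof -
  have x: "x \<in> A" "x \<notin> rel_interior A"
    using assms by (auto simp: frontier_def rel_interior_nonempty_interior)
  obtain a where a: "a \<noteq> 0" "\<And>y. y \<in> A \<Longrightarrow> a \<bullet> x \<le> a \<bullet> y"
    using supporting_hyperplane_rel_boundary[OF assms(2) x] by metis
  show ?thesis
  proof
    show "- (a /\<^sub>R norm a) \<in> sphere 0 1" using a(1) by simp
    show "outer_normal A x (- (a /\<^sub>R norm a))"
      using a x(1) by (auto simp: outer_normal_def inner_diff_right divide_simps)
  qed
qed

text \<open>
  A fixed set contains a ball of radius \<open>\<epsilon>\<close>; this excludes the degenerate case in which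
  the supporting hyperplane at a frontier point contains the whole set.
\<close>

lemma interior_L_eps_fixed:
  assumes "\<epsilon> > 0" "A \<noteq> {}" "L_eps \<epsilon> L A = A"
  shows "interior A \<noteq> {}"
proof -
  obtain a where a: "a \<in> A" using assms(2) by blast
  have "cball (L *v a) \<epsilon> \<subseteq> A"
  proof
    fix z assume "z \<in> cball (L *v a) \<epsilon>"
    then have "norm (z - L *v a) \<le> \<epsilon>" by (simp add: dist_norm norm_minus_commute)
    then show "z \<in> A" using L_eps_memI[OF a, of "z - L *v a" \<epsilon> L] assms(3) by simp
  qed
  then show ?thesis using assms(1) by (metis empty_iff mem_interior_cball)
qed

lemma outward_unit_normal_bundle_L_eps_fixed:
  fixes L :: "real^'m^'m"
  assumes "\<epsilon> > 0" and ev: "\<forall>c. eigenvalue (map_matrix complex_of_real L) c \<longrightarrow> cmod c < 1"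
    and A: "compact A" "A \<noteq> {}" "L_eps \<epsilon> L A = A"
  shows "outward_unit_normal_bundle A = {(x, n). n \<in> sphere 0 1 \<and> outer_normal A x n}"
proof -
  have conv: "convex A" by (rule convex_L_eps_fixed[OF ev A])
  have cl: "closed A" using A(1) by (rule compact_imp_closed)
  have ex: "\<exists>n. n \<in> sphere 0 1 \<and> outer_normal A x n" if "x \<in> frontier A" for x
    using frontier_imp_exists_outer_normal[OF cl conv interior_L_eps_fixed[OF assms(1) A(2,3)] that]
    by metis
  have the: "outward_unit_normal A x = n" if "n \<in> sphere 0 1" "outer_normal A x n" for x n
    unfolding outward_unit_normal_def
  proof (rule the_equality)
    show "n \<in> sphere 0 1 \<and> (\<forall>a\<in>A. n \<bullet> (a - x) \<le> 0)"
      using that by (simp add: outer_normal_def)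
  next
    fix m assume "m \<in> sphere 0 1 \<and> (\<forall>a\<in>A. m \<bullet> (a - x) \<le> 0)"
    then have "m \<in> sphere 0 1" "outer_normal A x m" using that(2) by (auto simp: outer_normal_def)
    then show "m = n" using outer_normal_unique[OF assms(1) A(3)] that by metis
  qed
  have fr: "x \<in> frontier A" if "n \<in> sphere 0 1" "outer_normal A x n" for x n
    by (rule outer_normal_imp_frontier[of n]) (use that in auto)
  show ?thesis
  proof (intro set_eqI iffI; clarify)
    fix x n
    { assume "(x, n) \<in> outward_unit_normal_bundle A"
      then have "x \<in> frontier A" "n = outward_unit_normal A x"
        by (auto simp: outward_unit_normal_bundle_def)
      then show "n \<in> sphere 0 1 \<and> outer_normal A x n" using ex the by metis }
    { assume "n \<in> sphere 0 1" "outer_normal A x n"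
      then show "(x, n) \<in> outward_unit_normal_bundle A"
        using fr the by (auto simp: outward_unit_normal_bundle_def) }
  qed
qed

section \<open>Orbits of the boundary map\<close>

lemma funpow_boundary_map_normal:
  fixes L :: "real^'m^'m"
  assumes L: "\<epsilon> \<ge> 0" "invertible L" "L_eps \<epsilon> L A = A"
    and n: "n \<in> sphere 0 1" and xn: "outer_normal A x n"
  shows "snd ((boundary_map \<epsilon> L ^^ k) (x, n)) \<in> sphere 0 1 \<and>
    outer_normal A (fst ((boundary_map \<epsilon> L ^^ k) (x, n))) (snd ((boundary_map \<epsilon> L ^^ k) (x, n)))"
proof (induction k)
  case (Suc k)
  obtain x' n' where *: "(boundary_map \<epsilon> L ^^ k) (x, n) = (x', n')" by fastforce
  have "n' \<in> sphere 0 1" "outer_normal A x' n'" using Suc * by auto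
  moreover have "(boundary_map \<epsilon> L ^^ Suc k) (x, n) = (L *v x' + \<epsilon> *\<^sub>R L_perp L n', L_perp L n')"
    using * by (simp add: boundary_map_def)
  ultimately show ?case
    using outer_normal_image[OF L, of n' x'] transpose_L_perp[OF L(2), of n'] by (metis fst_conv snd_conv)
qed (use n xn in simp)

text \<open>
  Two orbits that start with the same normal keep equal normals, so the nonlinear part of the boundary
  map cancels in their difference.
\<close>

lemma funpow_boundary_map_diff:
  "(boundary_map \<epsilon> L ^^ k) (y, n) - (boundary_map \<epsilon> L ^^ k) (x, n) = (((*v) L ^^ k) (y - x), 0)"
proof (induction k)
  case (Suc k)
  obtain x' n' where 1: "(boundary_map \<epsilon> L ^^ k) (x, n) = (x', n')" by fastforce
  obtain y' m' where 2: "(boundary_map \<epsilon> L ^^ k) (y, n) = (y', m')" by fastforce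
  have "y' - x' = ((*v) L ^^ k) (y - x)" "m' = n'" using Suc 1 2 by simp_all
  then show ?case using 1 2
    by (simp add: boundary_map_def matrix_vector_mult_diff_distrib[symmetric])
qed simp

theorem theorem4p3:
  fixes L :: "real^'m^'m" and \<epsilon> :: real and A :: "(real^'m) set"
  assumes "\<epsilon> > 0"
    and "invertible L"
    and "\<And>c. eigenvalue (map_matrix complex_of_real L) c \<Longrightarrow> cmod c < 1"
    and "compact A" and "A \<noteq> {}" and "L_eps \<epsilon> L A = A"
  shows "(\<forall>n \<in> sphere 0 1. summable (x_term L n)) \<and>
    outward_unit_normal_bundle A = {(x_of_normal \<epsilon> L n, n) | n. n \<in> sphere 0 1} \<and>
    globally_attracting (boundary_map \<epsilon> L) (outward_unit_normal_bundle A)"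
proof (intro conjI)
  have ev: "\<forall>c. eigenvalue (map_matrix complex_of_real L) c \<longrightarrow> cmod c < 1"
    using assms(3) by blast
  have eps: "\<epsilon> \<ge> 0" using assms(1) by simp
  define N where "N = {(x, n). n \<in> sphere 0 1 \<and> outer_normal A x n}"
  have bundle_N: "outward_unit_normal_bundle A = N"
    unfolding N_def by (rule outward_unit_normal_bundle_L_eps_fixed[OF assms(1) ev assms(4-6)])
  show "\<forall>n \<in> sphere 0 1. summable (x_term L n)"
    using summable_x_term[OF ev assms(2)] by blast
  have graph: "outer_normal A x n \<longleftrightarrow> x = x_of_normal \<epsilon> L n" if "n \<in> sphere 0 1" for x n
  proof -
    have "y = x_of_normal \<epsilon> L n" if "outer_normal A y n" for y
      using outer_normal_eq_x_of_normal[OF ev eps assms(2,6) compact_imp_bounded[OF assms(4)]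
          \<open>n \<in> sphere 0 1\<close> that] .
    then show ?thesis using exists_outer_normal_point[OF assms(4,5), of n] by metis
  qed
  show "outward_unit_normal_bundle A = {(x_of_normal \<epsilon> L n, n) | n. n \<in> sphere 0 1}"
    unfolding bundle_N N_def using graph by auto
  have attr: "(\<lambda>k. infdist ((boundary_map \<epsilon> L ^^ k) (y, n)) N) \<longlonglongrightarrow> 0"
    if n: "n \<in> sphere 0 1" for y n
  proof -
    obtain x where x: "outer_normal A x n" using exists_outer_normal_point[OF assms(4,5)] by metis
    have le: "infdist ((boundary_map \<epsilon> L ^^ k) (y, n)) N \<le> norm (((*v) L ^^ k) (y - x))" for k
    proof -
      have "(boundary_map \<epsilon> L ^^ k) (x, n) \<in> N"
        using funpow_boundary_map_normal[OF eps assms(2,6) n x, of k] by (simp add: N_def case_prod_beta)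
      then have "infdist ((boundary_map \<epsilon> L ^^ k) (y, n)) N
          \<le> dist ((boundary_map \<epsilon> L ^^ k) (y, n)) ((boundary_map \<epsilon> L ^^ k) (x, n))"
        by (rule infdist_le)
      also have "\<dots> = norm (((*v) L ^^ k) (y - x))"
        by (simp add: dist_norm funpow_boundary_map_diff norm_Pair)
      finally show ?thesis .
    qed
    have "(\<lambda>k. norm (((*v) L ^^ k) (y - x))) \<longlonglongrightarrow> 0"
      by (rule summable_LIMSEQ_zero[OF summable_norm_funpow[OF ev]])
    then show ?thesis
      by (rule metric_tendsto_imp_tendsto) (simp add: le infdist_nonneg)
  qed
  have "N \<noteq> {}"
  proof -
    obtain n :: "real^'m" where "n \<in> sphere 0 1"
      using vector_choose_size[of 1] by auto
    then show ?thesis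
      unfolding N_def by (auto intro: exists_outer_normal_point[OF assms(4,5), of n])
  qed
  then show "globally_attracting (boundary_map \<epsilon> L) (outward_unit_normal_bundle A)"
    unfolding bundle_N globally_attracting_def using attr by (auto simp: N_def)
qed

end
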